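(* For all positive integers $m, n, p$ with $m\ge (n^2+2pn+n-3)/2$, we have $\hat r_c(nK_{1,p},K_{1,m})=n(m+p)-1$.
   Context: All graphs are finite and simple. $K_{1,m}$ denotes the star with $m$ edges (a tree with $m$ edges sharing a common endpoint), and $nK_{1,p}$ denotes the disjoint union of $n$ copies of $K_{1,p}$. For graphs $G, G_1, G_2$, we write $G\to(G_1,G_2)$ if every red-blue coloring of the edges of $G$ contains a red subgraph isomorphic to $G_1$ or a blue subgraph isomorphic to $G_2$. The connected size Ramsey number $\hat r_c(G_1,G_2)$ is the minimum number of edges of a connected graph $G$ with $G\to(G_1,G_2)$. *)

theory Defs
  imports Complex_Main
begin

record 'a graph =
  verts :: "'a set"
  edges :: "'a set set"

definition simple_graph :: "'a graph \<Rightarrow> bool" where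
  "simple_graph G \<longleftrightarrow>
     finite (verts G) \<and> (\<forall>e \<in> edges G. e \<subseteq> verts G \<and> card e = 2)"

definition connected_graph :: "'a graph \<Rightarrow> bool" where
  "connected_graph G \<longleftrightarrow> verts G \<noteq> {} \<and>
     (\<forall>u \<in> verts G. \<forall>v \<in> verts G. (u, v) \<in> {(x, y). {x, y} \<in> edges G}\<^sup>*)"

definition subgraph_of :: "'a graph \<Rightarrow> 'a graph \<Rightarrow> bool" where
  "subgraph_of H G \<longleftrightarrow> simple_graph H \<and> verts H \<subseteq> verts G \<and> edges H \<subseteq> edges G"

definition isomorphic :: "'a graph \<Rightarrow> 'b graph \<Rightarrow> bool" where
  "isomorphic G H \<longleftrightarrow>
     (\<exists>f. bij_betw f (verts G) (verts H) \<and> edges H = (\<lambda>e. f ` e) ` edges G)"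

datatype colour = Red | Blue

definition colour_class :: "'a graph \<Rightarrow> ('a set \<Rightarrow> colour) \<Rightarrow> colour \<Rightarrow> 'a graph" where
  "colour_class G c k = \<lparr>verts = verts G, edges = {e \<in> edges G. c e = k}\<rparr>"

(* A colouring is a total function on vertex sets; only its values on the edges of G matter. *)
definition arrows :: "'a graph \<Rightarrow> 'b graph \<Rightarrow> 'c graph \<Rightarrow> bool" where
  "arrows G G1 G2 \<longleftrightarrow> (\<forall>c.
     (\<exists>H. subgraph_of H (colour_class G c Red) \<and> isomorphic H G1) \<or>
     (\<exists>H. subgraph_of H (colour_class G c Blue) \<and> isomorphic H G2))"

(* Every finite graph is isomorphic to one whose vertices are natural numbers, so letting G
   range over graphs on nat loses nothing. *)
definition connected_size_ramsey :: "'a graph \<Rightarrow> 'b graph \<Rightarrow> nat" where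
  "connected_size_ramsey G1 G2 = (LEAST k. \<exists>G :: nat graph.
     simple_graph G \<and> connected_graph G \<and> arrows G G1 G2 \<and> card (edges G) = k)"

definition star :: "nat \<Rightarrow> nat graph" where
  "star m = \<lparr>verts = {0..m}, edges = {{0, i} | i. i \<in> {1..m}}\<rparr>"

definition disjoint_copies :: "nat \<Rightarrow> 'a graph \<Rightarrow> (nat \<times> 'a) graph" where
  "disjoint_copies n H =
     \<lparr>verts = {..<n} \<times> verts H, edges = {Pair i ` e | i e. i < n \<and> e \<in> edges H}\<rparr>"

lemma simple_graph_star: "simple_graph (star m)"
  by (auto simp: simple_graph_def star_def card_insert_if)

lemma simple_graph_disjoint_copies:
  assumes "simple_graph H"
  shows "simple_graph (disjoint_copies n H)"
  using assms
  by (fastforce simp: simple_graph_def disjoint_copies_def card_image inj_on_def)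

end

theory Submission
  imports Defs
begin

text \<open>
  Upper bound: in a caterpillar whose $n$ spine vertices each carry $m + p - 1$ leaves, every
  spine vertex with fewer than $m$ blue edges has $p$ red leaves.

  Lower bound: let $S$ be the set of vertices of degree at least $m$ in a connected graph that
  arrows.  Colouring red exactly the edges that meet $S$ shows $|S| \ge n$, and if $|S| > n$ the
  edge count is already too large by the hypothesis on $m$.  So $|S| = n$, and every one of $n$
  disjoint red stars would contain exactly one vertex of $S$.  Colour red all edges inside $S$,
  and from each $v \in S$ to a set $R_v$ of $a_v$ neighbours outside $S$, where $a_v$ is
  the least number that leaves fewer than $m$ blue edges at $v$.  The stars need disjoint
  $p$-subsets of the sets $R_v$, so a choice of the $R_v$ that violates Hall's condition excludes
  them.  Such a choice, made by letting adjacent $R_v$ overlap along a tree, exists unless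
  $\sum a_v \ge (p + 1) |T| - 1$ on each component $T$ of the bipartite graph between $S$ and its
  complement.  Summing this over the components, and adding the edges that connectivity requires
  between different components, gives $n (m + p) - 1$ edges.
\<close>

section \<open>Copies of stars\<close>

text \<open>Working with a map instead of a subgraph and an isomorphism lets a copy of a star be
  given by naming the images of its centre and leaves.\<close>

definition embeds :: "'b graph \<Rightarrow> 'a graph \<Rightarrow> bool" where
  "embeds F K \<longleftrightarrow> (\<exists>g. inj_on g (verts F) \<and> g ` verts F \<subseteq> verts K \<and>
     (\<forall>e \<in> edges F. g ` e \<in> edges K))"

definition neighbours :: "'a graph \<Rightarrow> 'a \<Rightarrow> 'a set" where
  "neighbours G v = {w. {v, w} \<in> edges G}"

text \<open>Inverting the isomorphism gives an embedding. Conversely, the image of \<open>F\<close>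
  under an embedding is a simple subgraph, since injectivity keeps edges two-element.\<close>

lemma subgraph_isomorphic_iff_embeds:
  assumes "simple_graph F"
  shows "(\<exists>H. subgraph_of H K \<and> isomorphic H F) \<longleftrightarrow> embeds F K"
proof
  assume "\<exists>H. subgraph_of H K \<and> isomorphic H F"
  then obtain H where HK: "subgraph_of H K" and HF: "isomorphic H F" by blast
  from HF obtain f where f: "bij_betw f (verts H) (verts F)"
    and EF: "edges F = (\<lambda>e. f ` e) ` edges H"
    unfolding isomorphic_def by (elim exE conjE)
  have H: "simple_graph H" "verts H \<subseteq> verts K" "edges H \<subseteq> edges K"
    using HK unfolding subgraph_of_def by simp_all
  define g where "g = inv_into (verts H) f"
  have "bij_betw g (verts F) (verts H)"
    unfolding g_def by (rule bij_betw_inv_into[OF f])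
  moreover have "g ` e \<in> edges K" if e: "e \<in> edges F" for e
  proof -
    obtain e' where e': "e' \<in> edges H" "e = f ` e'" using e EF by blast
    have "e' \<subseteq> verts H" using H(1) e'(1) unfolding simple_graph_def by blast
    then have "g ` e = e'"
      using f unfolding e'(2) g_def bij_betw_def by (simp add: inv_into_image_cancel)
    then show ?thesis using e'(1) H(3) by blast
  qed
  ultimately show "embeds F K"
    unfolding embeds_def bij_betw_def using H(2) by blast
next
  assume "embeds F K"
  then obtain g where g: "inj_on g (verts F)" "g ` verts F \<subseteq> verts K"
    "\<forall>e \<in> edges F. g ` e \<in> edges K"
    unfolding embeds_def by blast
  define H where "H = \<lparr>verts = g ` verts F, edges = (\<lambda>e. g ` e) ` edges F\<rparr>"
  define f where "f = inv_into (verts F) g"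
  have FE: "finite (verts F)" "\<And>e. e \<in> edges F \<Longrightarrow> e \<subseteq> verts F \<and> card e = 2"
    using assms unfolding simple_graph_def by auto
  have "card (g ` e) = 2" if "e \<in> edges F" for e
    using FE(2)[OF that] card_image[OF inj_on_subset[OF g(1)], of e] by simp
  then have "subgraph_of H K"
    unfolding subgraph_of_def simple_graph_def H_def using FE g by auto
  moreover have "bij_betw f (verts H) (verts F)"
    unfolding f_def H_def using g(1) by (simp add: bij_betw_inv_into inj_on_imp_bij_betw)
  moreover have "f ` g ` e = e" if "e \<in> edges F" for e
    unfolding f_def using FE(2)[OF that] g(1) by (simp add: inv_into_image_cancel)
  then have "edges F = (\<lambda>e. f ` e) ` edges H"
    unfolding H_def by (simp add: image_image)
  ultimately show "\<exists>H. subgraph_of H K \<and> isomorphic H F"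
    unfolding isomorphic_def by (intro exI[of _ H] conjI exI[of _ f])
qed

lemma arrows_iff_embeds:
  assumes "simple_graph G1" "simple_graph G2"
  shows "arrows G G1 G2 \<longleftrightarrow>
    (\<forall>c. embeds G1 (colour_class G c Red) \<or> embeds G2 (colour_class G c Blue))"
  unfolding arrows_def subgraph_isomorphic_iff_embeds[OF assms(1)]
    subgraph_isomorphic_iff_embeds[OF assms(2)] ..

lemma simple_graph_edgeE:
  assumes "simple_graph G" "e \<in> edges G"
  obtains x y where "e = {x, y}" "x \<noteq> y" "x \<in> verts G" "y \<in> verts G"
  using assms unfolding simple_graph_def by (metis card_2_iff insert_subset)

lemma finite_edges: "simple_graph G \<Longrightarrow> finite (edges G)"
  unfolding simple_graph_def by (meson Pow_iff finite_Pow_iff finite_subset subsetI)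

lemma neighbours_subset: "simple_graph G \<Longrightarrow> neighbours G v \<subseteq> verts G - {v}"
  unfolding neighbours_def simple_graph_def by fastforce

lemma finite_neighbours: "simple_graph G \<Longrightarrow> finite (neighbours G v)"
  by (metis finite_Diff finite_subset neighbours_subset simple_graph_def)

lemma simple_graph_colour_class: "simple_graph G \<Longrightarrow> simple_graph (colour_class G c k)"
  unfolding simple_graph_def colour_class_def by auto

text \<open>Only the degree of the centre matters: the leaves may be any \<open>m\<close> of its
  neighbours, which differ from the centre because \<open>K\<close> has no loops.\<close>

lemma embeds_star_iff:
  assumes "simple_graph K"
  shows "embeds (star m) K \<longleftrightarrow> (\<exists>v \<in> verts K. m \<le> card (neighbours K v))"
proof
  assume "embeds (star m) K"
  then obtain g where g: "inj_on g {0..m}" "g ` {0..m} \<subseteq> verts K"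
    "\<forall>e \<in> {{0, i} | i. i \<in> {1..m}}. g ` e \<in> edges K"
    unfolding embeds_def star_def by auto
  have "{g 0, g i} \<in> edges K" if "i \<in> {1..m}" for i
    using bspec[OF g(3), of "{0, i}"] that by auto
  then have "g ` {1..m} \<subseteq> neighbours K (g 0)"
    unfolding neighbours_def by auto
  then have "card (g ` {1..m}) \<le> card (neighbours K (g 0))"
    by (rule card_mono[OF finite_neighbours[OF assms]])
  moreover have "card (g ` {1..m}) = m"
    using card_image[OF inj_on_subset[OF g(1), of "{1..m}"]] by simp
  ultimately show "\<exists>v \<in> verts K. m \<le> card (neighbours K v)"
    using g(2) by (intro bexI[of _ "g 0"]) auto
next
  assume "\<exists>v \<in> verts K. m \<le> card (neighbours K v)"
  then obtain v where v: "v \<in> verts K" "m \<le> card (neighbours K v)" by blast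
  obtain W where W: "W \<subseteq> neighbours K v" "card W = m" "finite W"
    using obtain_subset_with_card_n[OF v(2)] by blast
  obtain h where h: "bij_betw h {1..m} W"
    using finite_same_card_bij[OF _ W(3), of "{1..m}"] W(2) by auto
  define g where "g i = (if i = 0 then v else h i)" for i
  have hW: "h i \<in> W" if "i \<in> {1..m}" for i using bij_betwE[OF h] that by blast
  have vW: "W \<subseteq> verts K" "v \<notin> W" using W(1) neighbours_subset[OF assms, of v] by blast+
  have "inj_on g {0..m}"
  proof (rule inj_onI)
    fix i j assume ij: "i \<in> {0..m}" "j \<in> {0..m}" "g i = g j"
    show "i = j"
    proof (cases "i = 0 \<or> j = 0")
      case True
      then show ?thesis using ij hW[of i] hW[of j] vW(2) unfolding g_def by (auto split: if_splits)
    next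
      case False
      then show ?thesis
        using ij inj_onD[OF bij_betw_imp_inj_on[OF h], of i j] unfolding g_def by simp
    qed
  qed
  moreover have "g ` {0..m} \<subseteq> verts K" using v(1) vW hW unfolding g_def by auto
  moreover have "g ` {0, i} \<in> edges K" if "i \<in> {1..m}" for i
    using subsetD[OF W(1) hW[OF that]] that unfolding g_def neighbours_def
    by (simp add: insert_commute)
  then have "\<forall>e \<in> edges (star m). g ` e \<in> edges K" unfolding star_def by auto
  ultimately show "embeds (star m) K"
    unfolding embeds_def by (intro exI[of _ g] conjI) (simp_all add: star_def)
qed

lemma embeds_disjoint_stars_iff:
  "embeds (disjoint_copies n (star p)) K \<longleftrightarrow>
    (\<exists>g. inj_on g ({..<n} \<times> {0..p}) \<and> g ` ({..<n} \<times> {0..p}) \<subseteq> verts K \<and>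
      (\<forall>i < n. \<forall>j \<in> {1..p}. {g (i, 0), g (i, j)} \<in> edges K))"
proof -
  have "edges (disjoint_copies n (star p)) = (\<lambda>(i, j). {(i, 0), (i, j)}) ` ({..<n} \<times> {1..p})"
    (is "_ = ?E")
  proof (intro set_eqI iffI)
    fix e assume "e \<in> edges (disjoint_copies n (star p))"
    then obtain i j where "i < n" "j \<in> {1..p}" "e = Pair i ` {0, j}"
      unfolding disjoint_copies_def star_def by auto
    then show "e \<in> ?E" by (intro image_eqI[of _ _ "(i, j)"]) auto
  next
    fix e assume "e \<in> ?E"
    then obtain i j where ij: "i < n" "j \<in> {1..p}" "e = Pair i ` {0, j}" by auto
    then have "{0, j} \<in> edges (star p)" unfolding star_def by auto
    with ij show "e \<in> edges (disjoint_copies n (star p))"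
      unfolding disjoint_copies_def by auto
  qed
  moreover have "verts (disjoint_copies n (star p)) = {..<n} \<times> {0..p}"
    unfolding disjoint_copies_def star_def by simp
  moreover have "(\<forall>e \<in> ?E. g ` e \<in> edges K) \<longleftrightarrow>
      (\<forall>i < n. \<forall>j \<in> {1..p}. {g (i, 0), g (i, j)} \<in> edges K)" for g
    by auto
  ultimately show ?thesis unfolding embeds_def by simp
qed

section \<open>Linked neighbourhoods\<close>

lemma card_insert_le_Suc: "card (insert x A) \<le> Suc (card A)"
  by (cases "finite A") (simp_all add: card_insert_if)

lemma rtrancl_exit:
  assumes "(x, y) \<in> r\<^sup>*" "P x" "\<not> P y"
  shows "\<exists>u v. (u, v) \<in> r \<and> P u \<and> \<not> P v"
  using assms by (induction rule: rtrancl_induct) auto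

text \<open>Identifying vertices with equal labels leaves a connected multigraph on the labels,
  which has at least the edges of a spanning tree. The proof grows a set of labels, with one
  crossing edge for each new label.\<close>

lemma card_labels_le_card_cross_edges:
  assumes "simple_graph G" "connected_graph G"
  shows "card (f ` verts G) \<le> card {e \<in> edges G. \<exists>x \<in> e. \<exists>y \<in> e. f x \<noteq> f y} + 1"
proof -
  let ?X = "{e \<in> edges G. \<exists>x \<in> e. \<exists>y \<in> e. f x \<noteq> f y}"
  have fin: "finite (f ` verts G)" using assms(1) unfolding simple_graph_def by blast
  have finX: "finite ?X" using finite_edges[OF assms(1)] by simp
  \<comment> \<open>Only crossing edges with both labels in \<open>A\<close> are counted, so an edge
    that leaves \<open>A\<close> is new when its outer label is added.\<close>
  have "\<exists>A \<subseteq> f ` verts G. card A = Suc k \<and> k \<le> card {e \<in> ?X. f ` e \<subseteq> A}"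
    if "k < card (f ` verts G)" for k
    using that
  proof (induction k)
    case 0
    then obtain a where "a \<in> f ` verts G" by fastforce
    then show ?case by (intro exI[of _ "{a}"]) simp
  next
    case (Suc k)
    then obtain A where A: "A \<subseteq> f ` verts G" "card A = Suc k"
      "k \<le> card {e \<in> ?X. f ` e \<subseteq> A}" by auto
    have finA: "finite A" using A(1) fin finite_subset by blast
    have "A \<noteq> {}" using A(2) by auto
    then obtain x where x: "x \<in> verts G" "f x \<in> A" using A(1) by blast
    have "A \<noteq> f ` verts G" using A(2) Suc.prems by auto
    then obtain y where y: "y \<in> verts G" "f y \<notin> A" using A(1) by auto
    have "(x, y) \<in> {(x, y). {x, y} \<in> edges G}\<^sup>*"
      using assms(2) x(1) y(1) unfolding connected_graph_def by blast
    from rtrancl_exit[OF this, of "\<lambda>z. f z \<in> A"] x y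
    obtain u v where uv: "{u, v} \<in> edges G" "f u \<in> A" "f v \<notin> A" by auto
    have v: "v \<in> verts G" using assms(1) uv(1) unfolding simple_graph_def by blast
    let ?B = "insert (f v) A"
    have "insert {u, v} {e \<in> ?X. f ` e \<subseteq> A} \<subseteq> {e \<in> ?X. f ` e \<subseteq> ?B}"
      using uv by auto
    then have "card (insert {u, v} {e \<in> ?X. f ` e \<subseteq> A}) \<le> card {e \<in> ?X. f ` e \<subseteq> ?B}"
      by (intro card_mono finite_subset[OF _ finX]) auto
    moreover have "card (insert {u, v} {e \<in> ?X. f ` e \<subseteq> A}) = Suc (card {e \<in> ?X. f ` e \<subseteq> A})"
      using uv by (intro card_insert_disjoint finite_subset[OF _ finX]) auto
    ultimately have "Suc k \<le> card {e \<in> ?X. f ` e \<subseteq> ?B}" using A(3) by linarith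
    moreover have "card ?B = Suc (Suc k)" using A(2) uv(3) finA by simp
    ultimately show ?case using A(1) v by (intro exI[of _ ?B]) auto
  qed
  moreover have "card (f ` verts G) > 0"
    using fin assms(2) unfolding connected_graph_def by (simp add: card_gt_0_iff)
  then have "card (f ` verts G) - 1 < card (f ` verts G)" by simp
  ultimately obtain A where "card (f ` verts G) - 1 \<le> card {e \<in> ?X. f ` e \<subseteq> A}"
    by blast
  moreover have "\<dots> \<le> card ?X" by (intro card_mono finX) auto
  ultimately show ?thesis by linarith
qed

text \<open>
  A linked set is built so that each new member shares a neighbour with an earlier one; the order
  of construction takes the place of a spanning tree.
\<close>

inductive linked :: "('a \<Rightarrow> 'b set) \<Rightarrow> 'a set \<Rightarrow> bool" for N where
  single: "linked N {v}"
| link: "linked N T \<Longrightarrow> u \<in> T \<Longrightarrow> v \<notin> T \<Longrightarrow> w \<in> N u \<Longrightarrow> w \<in> N v \<Longrightarrow> linked N (insert v T)"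

lemma linked_finite: "linked N T \<Longrightarrow> finite T"
  by (induction rule: linked.induct) auto

text \<open>
  If the last member $v$ has $a_v > p$, it is dropped.
  If $a_v = p$, the requirement at its partner $u$ is lowered by one: afterwards the shared
  neighbour $w$ is put into both $R_u$ and $R_v$, so the union grows by at most $p$.
\<close>

lemma linked_deficient:
  assumes "linked N T"
    and "\<And>v. v \<in> T \<Longrightarrow> finite (N v)" and "\<And>v. v \<in> T \<Longrightarrow> a v \<le> card (N v)"
    and "sum a T + 2 \<le> (p + 1) * card T" and "p \<ge> 1"
  shows "\<exists>T' \<subseteq> T. \<exists>R. (\<forall>v \<in> T'. R v \<subseteq> N v \<and> a v \<le> card (R v)) \<and>
    card (\<Union>v \<in> T'. R v) < p * card T'"
proof -
  \<comment> \<open>A vertex that asks for fewer than \<open>p\<close> elements violates Hall's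
    condition by itself.\<close>
  have small: "\<exists>T' \<subseteq> T. \<exists>R. (\<forall>v \<in> T'. R v \<subseteq> N v \<and> b v \<le> card (R v)) \<and>
      card (\<Union>v \<in> T'. R v) < p * card T'"
    if v: "v \<in> T" "b v < p" "b v \<le> card (N v)" for v T and b :: "'a \<Rightarrow> nat"
  proof -
    obtain W where "W \<subseteq> N v" "card W = b v" using obtain_subset_with_card_n[OF v(3)] by blast
    then show ?thesis using v by (intro exI[of _ "{v}"] conjI exI[of _ "\<lambda>_. W"]) auto
  qed
  from assms show ?thesis
  proof (induction arbitrary: a rule: linked.induct)
    case (single v)
    then show ?case by (intro small[of v]) auto
  next
    case (link T u v w)
    have finT: "finite T" using link.hyps(1) by (rule linked_finite)
    have sum: "sum a T + a v + 2 \<le> (p + 1) * card T + p + 1"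
      using link.prems(3) link.hyps(3) finT by (simp add: algebra_simps)
    \<comment> \<open>The first two cases end with a single vertex. The case \<open>a u = 0\<close>
      is split off so that \<open>a u - 1\<close> below is a true subtraction.\<close>
    consider "a v < p" | "a u = 0" | "a v > p" | "a v = p" "a u > 0" by linarith
    then show ?case
    proof cases
      case 1
      then show ?thesis using link.prems(2) by (intro small[of v]) auto
    next
      case 2
      then show ?thesis using link.prems(2,4) link.hyps(2) by (intro small[of u]) auto
    next
      case 3
      then have "\<exists>T' \<subseteq> T. \<exists>R. (\<forall>v \<in> T'. R v \<subseteq> N v \<and> a v \<le> card (R v)) \<and>
        card (\<Union>v \<in> T'. R v) < p * card T'"
        using link.prems sum by (intro link.IH) auto
      then show ?thesis using subset_insertI2[of _ T v] by blast
    next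
      case 4
      \<comment> \<open>Removing \<open>v\<close> takes \<open>p\<close> from the sum but
        \<open>p + 1\<close> from the bound, so the gap of 2 drops to 1; lowering \<open>a u\<close>
        restores it.\<close>
      define b where "b = a(u := a u - 1)"
      have b: "b x \<le> a x" for x unfolding b_def by auto
      have "sum a T = sum b T + 1"
        using link.hyps(2) finT 4(2) unfolding b_def by (simp add: sum.remove[of T u])
      then have "\<exists>T' \<subseteq> T. \<exists>R. (\<forall>v \<in> T'. R v \<subseteq> N v \<and> b v \<le> card (R v)) \<and>
        card (\<Union>v \<in> T'. R v) < p * card T'"
        using link.prems sum 4(1) le_trans[OF b] by (intro link.IH) auto
      then obtain T' R where T': "T' \<subseteq> T" "\<And>v. v \<in> T' \<Longrightarrow> R v \<subseteq> N v"
        "\<And>v. v \<in> T' \<Longrightarrow> b v \<le> card (R v)" "card (\<Union>v \<in> T'. R v) < p * card T'"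
        by blast
      show ?thesis
      proof (cases "u \<in> T'")
        case False
        then have "a x = b x" if "x \<in> T'" for x using that unfolding b_def by auto
        then show ?thesis using T' by (intro exI[of _ T'] conjI exI[of _ R]) auto
      next
        case True
        have finN: "finite (N u)" using link.prems(1) link.hyps(2) by blast
        have finR: "finite (R x)" if "x \<in> T'" for x
          using T'(1,2) that link.prems(1) by (meson finite_subset insertCI subsetD)
        \<comment> \<open>One new element must do two things: restore the lowered requirement at
          \<open>u\<close> and ensure that \<open>w\<close> lies in the set there.\<close>
        obtain z where z: "z \<in> N u" "a u \<le> card (insert z (R u))" "w \<in> insert z (R u)"
        proof (cases "w \<in> R u \<and> card (R u) < a u")
          case True
          then have "R u \<subset> N u"
            using T'(2)[OF \<open>u \<in> T'\<close>] link.prems(2)[of u] link.hyps(2) by auto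
          then obtain z where "z \<in> N u" "z \<notin> R u" by blast
          moreover have "a u \<le> card (R u) + 1"
            using T'(3)[OF \<open>u \<in> T'\<close>] unfolding b_def by simp
          ultimately show ?thesis using that[of z] True finR[OF \<open>u \<in> T'\<close>] by simp
        next
          case False
          then show ?thesis
            using that[of w] link.hyps(4) T'(3)[OF \<open>u \<in> T'\<close>] finR[OF \<open>u \<in> T'\<close>]
            unfolding b_def by (cases "w \<in> R u") (auto simp: insert_absorb)
        qed
        have finNv: "finite (N v)" using link.prems(1) by blast
        have "p - 1 \<le> card (N v - {w})"
          using link.prems(2)[of v] 4(1) link.hyps(5) finNv by simp
        then obtain W where W: "W \<subseteq> N v - {w}" "card W = p - 1" "finite W"
          using obtain_subset_with_card_n by blast
        (* z is w, unless w already lies in R u and one more element is needed there *)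
        define R' where "R' = R(u := insert z (R u), v := insert w W)"
        have vT': "v \<notin> T'" and uv: "u \<noteq> v" using T'(1) link.hyps by auto
        have "card (insert w W) = p"
          using W assms(5) by (subst card_insert_disjoint) auto
        moreover have "a x \<le> card (R x)" if "x \<in> T'" "x \<noteq> u" for x
          using T'(3)[OF that(1)] that(2) unfolding b_def by simp
        ultimately have R': "\<forall>x \<in> insert v T'. R' x \<subseteq> N x \<and> a x \<le> card (R' x)"
          using T'(2) z(1,2) W(1) link.hyps(5) uv 4(1) unfolding R'_def by auto
        \<comment> \<open>Since \<open>w\<close> already lies in the set at \<open>u\<close>, only
          \<open>z\<close> and the \<open>p - 1\<close> elements of \<open>W\<close> can be new,
          which matches the extra \<open>p\<close> allowed for \<open>v\<close>.\<close>
        have "(\<Union>x \<in> insert v T'. R' x) \<subseteq> insert z (W \<union> (\<Union>x \<in> T'. R x))" (is "?U \<subseteq> _")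
          using z(3) True vT' unfolding R'_def by (auto split: if_splits)
        then have "card ?U \<le> card (insert z (W \<union> (\<Union>x \<in> T'. R x)))"
          using finR W(3) finite_subset[OF T'(1) finT] by (intro card_mono) auto
        moreover have "\<dots> \<le> Suc (card (W \<union> (\<Union>x \<in> T'. R x)))"
          by (rule card_insert_le_Suc)
        moreover have "card (W \<union> (\<Union>x \<in> T'. R x)) \<le> card W + card (\<Union>x \<in> T'. R x)"
          by (rule card_Un_le)
        ultimately have "card ?U < p + p * card T'"
          using T'(4) W(2) assms(5) by linarith
        moreover have "card (insert v T') = Suc (card T')"
          using vT' finite_subset[OF T'(1) finT] by simp
        ultimately have "card ?U < p * card (insert v T')" by simp
        moreover have "insert v T' \<subseteq> insert v T" using T'(1) by blast
        ultimately show ?thesis using R' by blast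
      qed
    qed
  qed
qed

section \<open>Edge counts\<close>

lemma card_neighbours:
  assumes "simple_graph G"
  shows "card (neighbours G v) = card {e \<in> edges G. v \<in> e}"
proof -
  have "{e \<in> edges G. v \<in> e} = (\<lambda>w. {v, w}) ` neighbours G v"
  proof (intro set_eqI iffI)
    fix e assume e: "e \<in> {e \<in> edges G. v \<in> e}"
    then obtain x y where "e = {x, y}" using simple_graph_edgeE[OF assms] by blast
    with e show "e \<in> (\<lambda>w. {v, w}) ` neighbours G v"
      unfolding neighbours_def by (auto simp: insert_commute)
  qed (auto simp: neighbours_def)
  moreover have "inj_on (\<lambda>w. {v, w}) (neighbours G v)"
    by (auto simp: inj_on_def doubleton_eq_iff)
  ultimately show ?thesis by (simp add: card_image)
qed

text \<open>The degree sum counts an edge once for each endpoint in \<open>S\<close>, so only edges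
  inside \<open>S\<close> count twice, and these are at most the pairs in \<open>S\<close>.\<close>

lemma sum_card_neighbours_le:
  assumes "simple_graph G" "finite S"
  shows "(\<Sum>v \<in> S. card (neighbours G v)) \<le> card (edges G) + (card S choose 2)"
proof -
  have finE: "finite (edges G)" by (rule finite_edges[OF assms(1)])
  have "(\<Sum>v \<in> S. card (neighbours G v)) = (\<Sum>e \<in> edges G. card {v \<in> S. v \<in> e})"
    unfolding card_neighbours[OF assms(1)] by (rule sum_multicount_gen[OF assms(2) finE]) simp
  also have "\<dots> \<le> (\<Sum>e \<in> edges G. 1 + (if e \<subseteq> S then 1 else 0))"
  proof (rule sum_mono)
    fix e assume e: "e \<in> edges G"
    have "card e = 2" "finite e"
      using assms(1) e unfolding simple_graph_def by (auto intro: finite_subset)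
    moreover have "card {v \<in> S. v \<in> e} < card e" if "\<not> e \<subseteq> S"
      using that \<open>finite e\<close> by (intro psubset_card_mono) auto
    moreover have "card {v \<in> S. v \<in> e} \<le> card e"
      using \<open>finite e\<close> by (intro card_mono) auto
    ultimately show "card {v \<in> S. v \<in> e} \<le> 1 + (if e \<subseteq> S then 1 else 0)"
      by (cases "e \<subseteq> S") auto
  qed
  also have "\<dots> = card (edges G) + card {e \<in> edges G. e \<subseteq> S}"
    unfolding sum.distrib sum.inter_filter[OF finE, symmetric] by simp
  also have "card {e \<in> edges G. e \<subseteq> S} \<le> card {e. e \<subseteq> S \<and> card e = 2}"
    using assms unfolding simple_graph_def by (intro card_mono) auto
  also have "\<dots> = card S choose 2" by (rule n_subsets[OF assms(2)])
  finally show ?thesis by simp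
qed

section \<open>Components of the bipartite graph between \<open>S\<close> and its complement\<close>

definition cut_rel :: "'a graph \<Rightarrow> 'a set \<Rightarrow> ('a \<times> 'a) set" where
  "cut_rel G S = {(x, y). {x, y} \<in> edges G \<and> (x \<in> S \<longleftrightarrow> y \<notin> S)}"

text \<open>The trace on \<open>S\<close> of a component of the bipartite graph. It is defined for
  \<open>x\<close> outside \<open>S\<close> too, so that it labels all vertices; those outside
  \<open>S\<close> with no neighbour in \<open>S\<close> share the empty label.\<close>

definition cut_class :: "'a graph \<Rightarrow> 'a set \<Rightarrow> 'a \<Rightarrow> 'a set" where
  "cut_class G S x = {u \<in> S. (x, u) \<in> (cut_rel G S)\<^sup>*}"

lemma sym_cut_rel: "sym (cut_rel G S)"
  unfolding cut_rel_def by (auto intro!: symI simp: insert_commute)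

lemma cut_class_eq:
  assumes "(x, y) \<in> (cut_rel G S)\<^sup>*"
  shows "cut_class G S x = cut_class G S y"
proof -
  have "(y, x) \<in> (cut_rel G S)\<^sup>*"
    using symD[OF sym_rtrancl[OF sym_cut_rel] assms] .
  then have "(x, u) \<in> (cut_rel G S)\<^sup>* \<longleftrightarrow> (y, u) \<in> (cut_rel G S)\<^sup>*" for u
    using assms rtrancl_trans[of x y] rtrancl_trans[of y x] by auto
  then show ?thesis unfolding cut_class_def by simp
qed

text \<open>A maximal linked subset of the class that contains \<open>v\<close> is the whole class:
  paths alternate between \<open>S\<close> and its complement, so a path could leave the subset only
  through a neighbour shared with one of its members.\<close>

lemma linked_cut_class:
  assumes "finite S" "v \<in> S"
  shows "linked (\<lambda>v. neighbours G v - S) (cut_class G S v)"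
proof -
  let ?N = "\<lambda>v. neighbours G v - S" and ?T = "cut_class G S v"
  define F where "F = {M. M \<subseteq> ?T \<and> v \<in> M \<and> linked ?N M}"
  have "F \<subseteq> Pow ?T" "finite (Pow ?T)"
    using assms(1) unfolding F_def cut_class_def by auto
  then have finF: "finite F" by (rule finite_subset)
  have "v \<in> ?T" using assms(2) unfolding cut_class_def by simp
  then have "{v} \<in> F" unfolding F_def by (simp add: linked.single)
  then have "F \<noteq> {}" by blast
  from finite_has_maximal[OF finF this] obtain M where "M \<in> F"
    and max: "\<And>M'. M' \<in> F \<Longrightarrow> M \<subseteq> M' \<Longrightarrow> M = M'" by blast
  then have M: "M \<subseteq> ?T" "v \<in> M" "linked ?N M" unfolding F_def by auto
  \<comment> \<open>The invariant must also cover the vertices of the path outside \<open>S\<close>: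
    these are adjacent to a member of \<open>M\<close>.\<close>
  have reach: "y \<in> M \<or> (y \<notin> S \<and> (\<exists>u \<in> M. y \<in> ?N u))" if "(v, y) \<in> (cut_rel G S)\<^sup>*" for y
    using that
  proof (induction rule: rtrancl_induct)
    case base
    then show ?case using M(2) by simp
  next
    case (step y z)
    have MS: "M \<subseteq> S" using M(1) unfolding cut_class_def by blast
    show ?case
    proof (cases "y \<in> M")
      case True
      then show ?thesis using step.hyps(2) MS unfolding cut_rel_def neighbours_def by blast
    next
      case False
      then obtain u where u: "u \<in> M" "y \<in> ?N u" using step.IH by blast
      have z: "z \<in> S" "y \<in> ?N z"
        using step.hyps(2) u unfolding cut_rel_def neighbours_def by (auto simp: insert_commute)
      have "z \<in> ?T"
        using rtrancl_into_rtrancl[OF step.hyps] z(1) unfolding cut_class_def by blast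
      \<comment> \<open>\<open>y\<close> is a common neighbour of \<open>u\<close> and
        \<open>z\<close>, so maximality forces \<open>z\<close> into \<open>M\<close>.\<close>
      then have "z \<notin> M \<Longrightarrow> insert z M \<in> F"
        using M u z(2) linked.link[of ?N M u z y] unfolding F_def by auto
      then show ?thesis using max[of "insert z M"] by blast
    qed
  qed
  have "?T \<subseteq> M" using reach unfolding cut_class_def by blast
  then show ?thesis using M(1,3) by simp
qed

section \<open>The lower bound\<close>

text \<open>Every star has an edge and hence a vertex in \<open>S\<close>, and disjoint stars have
  different ones. If \<open>S\<close> has exactly \<open>n\<close> elements, these choices exhaust
  it and leave no second element for any star.\<close>

lemma star_transversal:
  fixes g :: "nat \<times> nat \<Rightarrow> 'a"
  assumes inj: "inj_on g ({..<n} \<times> {0..p})" and "p \<ge> 1" and "finite S"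
    and meet: "\<And>i j. i < n \<Longrightarrow> j \<in> {1..p} \<Longrightarrow> g (i, 0) \<in> S \<or> g (i, j) \<in> S"
  shows "n \<le> card S"
    and "card S = n \<Longrightarrow> v \<in> S \<Longrightarrow> \<exists>i < n. g ` ({i} \<times> {0..p}) \<inter> S = {v}"
proof -
  have "\<exists>j \<le> p. g (i, j) \<in> S" if "i < n" for i
  proof -
    have "g (i, 0) \<in> S \<or> g (i, 1) \<in> S" using meet[OF that, of 1] assms(2) by simp
    then show ?thesis using assms(2) by blast
  qed
  then obtain t where t: "\<And>i. i < n \<Longrightarrow> t i \<le> p \<and> g (i, t i) \<in> S" by metis
  define s where "s i = g (i, t i)" for i
  have eqD: "i = k" if "i < n" "k < n" "j \<le> p" "l \<le> p" "g (i, j) = g (k, l)" for i j k l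
    using inj_onD[OF inj that(5)] that by simp
  have "inj_on s {..<n}"
    using t eqD unfolding s_def by (intro inj_onI) blast
  then have card: "card (s ` {..<n}) = n" by (simp add: card_image)
  have sub: "s ` {..<n} \<subseteq> S" using t unfolding s_def by blast
  show "n \<le> card S" using card_mono[OF assms(3) sub] card by simp
  assume "card S = n" and v: "v \<in> S"
  then have S: "s ` {..<n} = S" using card_subset_eq[OF assms(3) sub] card by simp
  then obtain i where i: "i < n" "v = s i" using v by blast
  have "w = v" if w: "w \<in> g ` ({i} \<times> {0..p})" "w \<in> S" for w
  proof -
    obtain k where "k < n" "w = s k" using S w(2) by blast
    then show ?thesis using w(1) i eqD[of i k _ "t k"] t unfolding s_def by auto
  qed
  moreover have "v \<in> g ` ({i} \<times> {0..p})" using i t unfolding s_def by force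
  ultimately show "\<exists>i < n. g ` ({i} \<times> {0..p}) \<inter> S = {v}" using i(1) v by blast
qed

text \<open>As red edges meet \<open>S\<close>, disjoint red stars would force
  \<open>card S = n\<close> and one vertex of \<open>S\<close> per star. For each \<open>v\<close>
  in \<open>T\<close> the other \<open>p\<close> vertices of its star are red neighbours outside
  \<open>S\<close>, and disjointness makes the union too large. The condition on \<open>T\<close> is
  asked for only if \<open>card S = n\<close>, since a smaller \<open>S\<close> already excludes the
  stars.\<close>

lemma not_arrows_of_colouring:
  assumes G: "simple_graph G" and "p \<ge> 1" and S: "S \<subseteq> verts G"
    and meet: "\<And>e. e \<in> edges G \<Longrightarrow> c e = Red \<Longrightarrow> e \<inter> S \<noteq> {}"
    and blue: "\<And>v. v \<in> verts G \<Longrightarrow> card {w \<in> neighbours G v. c {v, w} = Blue} < m"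
    and red: "card S = n \<Longrightarrow> T \<subseteq> S \<and>
      card (\<Union>v \<in> T. {w \<in> neighbours G v. c {v, w} = Red} - S) < p * card T"
    and "card S \<le> n"
  shows "\<not> arrows G (disjoint_copies n (star p)) (star m)"
proof -
  have finS: "finite S" using S G unfolding simple_graph_def by (blast intro: finite_subset)
  have "\<not> embeds (star m) (colour_class G c Blue)"
  proof
    assume "embeds (star m) (colour_class G c Blue)"
    then obtain v where v: "v \<in> verts G" "m \<le> card (neighbours (colour_class G c Blue) v)"
      unfolding embeds_star_iff[OF simple_graph_colour_class[OF G]] by (auto simp: colour_class_def)
    have "neighbours (colour_class G c Blue) v = {w \<in> neighbours G v. c {v, w} = Blue}"
      unfolding neighbours_def colour_class_def by auto
    then show False using blue[OF v(1)] v(2) by simp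
  qed
  moreover have "\<not> embeds (disjoint_copies n (star p)) (colour_class G c Red)"
  proof
    assume "embeds (disjoint_copies n (star p)) (colour_class G c Red)"
    then obtain g where inj: "inj_on g ({..<n} \<times> {0..p})"
      and edge: "\<And>i j. i < n \<Longrightarrow> j \<in> {1..p} \<Longrightarrow>
        {g (i, 0), g (i, j)} \<in> edges G \<and> c {g (i, 0), g (i, j)} = Red"
      unfolding embeds_disjoint_stars_iff colour_class_def by auto
    have gS: "g (i, 0) \<in> S \<or> g (i, j) \<in> S" if "i < n" "j \<in> {1..p}" for i j
      using meet edge[OF that] by blast
    note transversal = star_transversal[OF inj assms(2) finS gS]
    have cardS: "card S = n" using transversal(1) assms(7) by simp
    let ?R = "\<lambda>v. {w \<in> neighbours G v. c {v, w} = Red} - S"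
    have T: "T \<subseteq> S" "card (\<Union>v \<in> T. ?R v) < p * card T" using red[OF cardS] by auto
    obtain k where k: "\<And>v. v \<in> S \<Longrightarrow> k v < n \<and> g ` ({k v} \<times> {0..p}) \<inter> S = {v}"
      using transversal(2)[OF _ _ cardS] by metis
    define D where "D v = g ` ({k v} \<times> {0..p}) - {v}" for v
    have cardD: "card (D v) = p" if "v \<in> S" for v
    proof -
      have "inj_on g ({k v} \<times> {0..p})" using k[OF that] by (intro inj_on_subset[OF inj]) auto
      then have "card (g ` ({k v} \<times> {0..p})) = p + 1"
        by (simp add: card_image card_cartesian_product)
      moreover have "v \<in> g ` ({k v} \<times> {0..p})" using k[OF that] by blast
      ultimately show ?thesis unfolding D_def by simp
    qed
    have DR: "D v \<subseteq> ?R v" if v: "v \<in> S" for v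
    proof
      fix w assume w: "w \<in> D v"
      then have wS: "w \<notin> S" using k[OF v] unfolding D_def by blast
      have kn: "k v < n" using k[OF v] by blast
      have "v \<in> g ` ({k v} \<times> {0..p})" using k[OF v] by blast
      then obtain a where a: "a \<le> p" "v = g (k v, a)" by auto
      obtain b where b: "b \<le> p" "w = g (k v, b)" using w unfolding D_def by auto
      have "{v, w} \<in> edges G \<and> c {v, w} = Red"
      proof (cases "a = 0")
        case True
        then have "b \<noteq> 0" using a(2) b(2) w unfolding D_def by (cases "b = 0") auto
        then show ?thesis using edge[OF kn, of b] True a(2) b by simp
      next
        case False
        \<comment> \<open>Here \<open>v\<close> is a leaf. The centre is another vertex of its star
          and so lies outside \<open>S\<close>; hence all leaves lie in \<open>S\<close>, and
          \<open>w\<close> must be the centre.\<close>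
        have "g (k v, 0) \<notin> S"
        proof
          assume "g (k v, 0) \<in> S"
          then have "g (k v, 0) \<in> g ` ({k v} \<times> {0..p}) \<inter> S" by simp
          then have "g (k v, 0) = v" using k[OF v] by simp
          then show False using inj_onD[OF inj, of "(k v, 0)" "(k v, a)"] a kn False by simp
        qed
        then have "b = 0" using gS[OF kn, of b] wS b by (cases "b = 0") auto
        then show ?thesis
          using edge[OF kn, of a] False a b(2) by (metis atLeastAtMost_iff insert_commute less_one not_less)
      qed
      then show "w \<in> ?R v" using wS unfolding neighbours_def by blast
    qed
    have finT: "finite T" using T(1) finS finite_subset by blast
    have "card (\<Union>v \<in> T. D v) = (\<Sum>v \<in> T. card (D v))"
    proof (rule card_UN_disjoint[OF finT])
      show "\<forall>v \<in> T. finite (D v)" unfolding D_def by simp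
      show "\<forall>u \<in> T. \<forall>v \<in> T. u \<noteq> v \<longrightarrow> D u \<inter> D v = {}"
      proof (intro ballI impI)
        fix u v assume uv: "u \<in> T" "v \<in> T" "u \<noteq> v"
        then have "k u \<noteq> k v" using k T(1) by (metis singleton_inject subsetD)
        moreover have "k u < n" "k v < n" using k uv T(1) by auto
        ultimately show "D u \<inter> D v = {}"
          using inj_onD[OF inj] unfolding D_def by fastforce
      qed
    qed
    also have "\<dots> = p * card T" using cardD T(1) by (simp add: subset_iff)
    finally have "card (\<Union>v \<in> T. D v) = p * card T" .
    moreover have "card (\<Union>v \<in> T. D v) \<le> card (\<Union>v \<in> T. ?R v)"
      using DR T(1) finT finite_neighbours[OF G] by (intro card_mono) auto
    ultimately show False using T(2) by simp
  qed
  ultimately show ?thesis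
    unfolding arrows_iff_embeds[OF simple_graph_disjoint_copies[OF simple_graph_star] simple_graph_star]
    by blast
qed

text \<open>With all edges that meet \<open>S\<close> red, a vertex of \<open>S\<close> has no blue
  edge and every other vertex has too small a degree, while the red stars would need
  \<open>n\<close> vertices of \<open>S\<close>.\<close>

lemma not_arrows_of_few_large:
  assumes G: "simple_graph G" and "m \<ge> 1" "p \<ge> 1" "S \<subseteq> verts G" "card S < n"
    and small: "\<And>v. v \<in> verts G - S \<Longrightarrow> card (neighbours G v) < m"
  shows "\<not> arrows G (disjoint_copies n (star p)) (star m)"
proof (rule not_arrows_of_colouring[OF G assms(3,4)])
  let ?c = "\<lambda>e. if e \<inter> S = {} then Blue else Red"
  show "card {w \<in> neighbours G v. ?c {v, w} = Blue} < m" if "v \<in> verts G" for v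
  proof (cases "v \<in> S")
    case True
    then show ?thesis using assms(2) by simp
  next
    case False
    have "card {w \<in> neighbours G v. ?c {v, w} = Blue} \<le> card (neighbours G v)"
      by (intro card_mono finite_neighbours[OF G]) auto
    then show ?thesis using small[of v] False that by simp
  qed
qed (use assms(5) in \<open>auto split: if_splits\<close>)

lemma not_arrows_of_deficient:
  assumes G: "simple_graph G" and "m \<ge> 1" "p \<ge> 1" and S: "S \<subseteq> verts G" "card S = n"
    and small: "\<And>v. v \<in> verts G - S \<Longrightarrow> card (neighbours G v) < m"
    and T: "T \<subseteq> S" "card (\<Union>v \<in> T. R v) < p * card T"
    and R: "\<And>v. v \<in> T \<Longrightarrow> R v \<subseteq> neighbours G v - S"
      "\<And>v. v \<in> T \<Longrightarrow> card (neighbours G v - S) < m + card (R v)"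
  shows "\<not> arrows G (disjoint_copies n (star p)) (star m)"
proof -
  \<comment> \<open>\<open>e - {v}\<close> is the other endpoint: of the edges that meet
    \<open>S\<close>, only those from some \<open>v\<close> in \<open>T\<close> to a vertex outside
    both \<open>S\<close> and \<open>R v\<close> are blue.\<close>
  define c where "c e = (if e \<inter> S \<noteq> {} \<and> (\<forall>v \<in> e \<inter> T. e - {v} \<subseteq> S \<union> R v) then Red else Blue)" for e
  have finN: "finite (neighbours G v)" for v by (rule finite_neighbours[OF G])
  have cT: "c {v, w} = Red \<longleftrightarrow> w \<in> R v" if "v \<in> T" "w \<notin> S" for v w
    using that T(1) unfolding c_def by auto
  have cS: "c {v, w} = Red" if "v \<in> S" "w \<in> S" for v w
    using that unfolding c_def by auto
  have cST: "c {v, w} = Red" if "v \<in> S - T" "w \<notin> S" for v w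
    using that T(1) unfolding c_def by auto
  show ?thesis
  proof (rule not_arrows_of_colouring[OF G assms(3) S(1), of c _ _ T])
    show "e \<inter> S \<noteq> {}" if "c e = Red" for e
      using that unfolding c_def by (auto split: if_splits)
    show "card {w \<in> neighbours G v. c {v, w} = Blue} < m" if v: "v \<in> verts G" for v
    proof -
      consider "v \<notin> S" | "v \<in> S - T" | "v \<in> T" by blast
      then show ?thesis
      proof cases
        case 1
        have "card {w \<in> neighbours G v. c {v, w} = Blue} \<le> card (neighbours G v)"
          by (intro card_mono finN) auto
        then show ?thesis using small[of v] 1 v by simp
      next
        case 2
        then have "{w \<in> neighbours G v. c {v, w} = Blue} = {}"
          using cS[of v] cST[of v] by (metis (mono_tags, lifting) Collect_empty_eq DiffD1 colour.distinct(1))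
        then show ?thesis using assms(2) by (metis card.empty less_le_trans zero_less_one)
      next
        case 3
        have "card {w \<in> neighbours G v. c {v, w} = Blue} \<le> card (neighbours G v - S - R v)"
        proof (intro card_mono finite_Diff finN subsetI)
          fix w assume w: "w \<in> {w \<in> neighbours G v. c {v, w} = Blue}"
          then have "w \<notin> S" using 3 T(1) cS[of v w] by auto
          then show "w \<in> neighbours G v - S - R v" using w cT[OF 3, of w] by auto
        qed
        also have "\<dots> = card (neighbours G v - S) - card (R v)"
          using R(1)[OF 3] finN by (intro card_Diff_subset) (auto intro: finite_subset)
        also have "\<dots> < m" using R(2)[OF 3] assms(2) by linarith
        finally show ?thesis .
      qed
    qed
    have "finite T" using G S(1) T(1) unfolding simple_graph_def by (meson finite_subset)
    then have "finite (\<Union>v \<in> T. R v)"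
      using R(1) finN by (meson finite_Diff finite_UN finite_subset)
    moreover have "(\<Union>v \<in> T. {w \<in> neighbours G v. c {v, w} = Red} - S) \<subseteq> (\<Union>v \<in> T. R v)"
      using cT by blast
    ultimately have "card (\<Union>v \<in> T. {w \<in> neighbours G v. c {v, w} = Red} - S) \<le> card (\<Union>v \<in> T. R v)"
      by (rule card_mono)
    then show "T \<subseteq> S \<and> card (\<Union>v \<in> T. {w \<in> neighbours G v. c {v, w} = Red} - S) < p * card T"
      using T by simp
  qed (simp add: S(2))
qed

text \<open>Edges between \<open>S\<close> and its complement join equal labels, so they are
  disjoint from the edges between different labels, of which connectivity demands at least the
  number of labels minus one.\<close>

lemma card_edges_ge_of_cut_classes:
  assumes G: "simple_graph G" "connected_graph G" and S: "S \<subseteq> verts G"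
  shows "(\<Sum>v \<in> S. card (neighbours G v - S)) + card (cut_class G S ` S) \<le> card (edges G) + 1"
proof -
  let ?N = "\<lambda>v. neighbours G v - S" and ?f = "cut_class G S"
  let ?X = "{e \<in> edges G. \<exists>x \<in> e. \<exists>y \<in> e. ?f x \<noteq> ?f y}"
  define L where "L = (\<lambda>(v, w). {v, w}) ` Sigma S ?N"
  have finV: "finite (verts G)" using G(1) unfolding simple_graph_def by blast
  have finS: "finite S" using S finV by (rule finite_subset)
  have finE: "finite (edges G)" by (rule finite_edges[OF G(1)])
  have "inj_on (\<lambda>(v, w). {v, w}) (Sigma S ?N)"
    by (auto simp: inj_on_def doubleton_eq_iff)
  then have cardL: "card L = (\<Sum>v \<in> S. card (?N v))"
    unfolding L_def using finS finite_neighbours[OF G(1)] by (simp add: card_image)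
  have LE: "L \<subseteq> edges G" unfolding L_def neighbours_def by auto
  have "?f v = ?f w" if "v \<in> S" "w \<in> ?N v" for v w
    using that by (intro cut_class_eq r_into_rtrancl) (auto simp: cut_rel_def neighbours_def)
  then have "e \<notin> ?X" if "e \<in> L" for e
    using that unfolding L_def by auto
  then have "card (L \<union> ?X) = card L + card ?X"
    using finE LE by (intro card_Un_disjoint) (auto intro: finite_subset)
  moreover have "card (L \<union> ?X) \<le> card (edges G)"
    using LE by (intro card_mono finE) auto
  moreover have "card (?f ` S) \<le> card (?f ` verts G)"
    using S finV by (intro card_mono) auto
  ultimately show ?thesis
    using card_labels_le_card_cross_edges[OF G, of ?f] cardL by linarith
qed

lemma card_edges_ge_of_arrows:
  assumes G: "simple_graph G" "connected_graph G"
    and arr: "arrows G (disjoint_copies n (star p)) (star m)"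
    and "m \<ge> 1" "n \<ge> 1" "p \<ge> 1" and large: "2 * m + 2 \<ge> n\<^sup>2 + 2 * p * n + n"
  shows "n * (m + p) - 1 \<le> card (edges G)"
proof -
  define S where "S = {v \<in> verts G. m \<le> card (neighbours G v)}"
  have finV: "finite (verts G)" using G(1) unfolding simple_graph_def by blast
  have SV: "S \<subseteq> verts G" and finS: "finite S" unfolding S_def using finV by auto
  have small: "card (neighbours G v) < m" if "v \<in> verts G - S" for v
    using that unfolding S_def by auto
  have "n \<le> card S"
    using not_arrows_of_few_large[OF G(1) assms(4,6) SV _ small, of n] arr not_le by blast
  then consider "card S = n" | "n + 1 \<le> card S" by linarith
  then show ?thesis
  proof cases
    case 2
    then obtain U where U: "U \<subseteq> S" "card U = n + 1" "finite U"
      using obtain_subset_with_card_n by blast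
    have "(n + 1) * m \<le> (\<Sum>v \<in> U. card (neighbours G v))"
      using sum_bounded_below[of U m "\<lambda>v. card (neighbours G v)"] U(1,2) unfolding S_def by auto
    then have "(n + 1) * m \<le> card (edges G) + (n + 1 choose 2)"
      using sum_card_neighbours_le[OF G(1) U(3)] U(2) by simp
    moreover have "2 * (n + 1 choose 2) = n * (n + 1)"
      by (simp add: choose_two)
    ultimately have "2 * (n + 1) * m \<le> 2 * card (edges G) + n * (n + 1)" by simp
    \<comment> \<open>The resulting bound, \<open>(n + 1) * m\<close> minus the number of pairs,
      reaches \<open>n * (m + p) - 1\<close> exactly when \<open>large\<close> holds.\<close>
    then show ?thesis using large by (simp add: algebra_simps power2_eq_square)
  next
    case 1
    let ?N = "\<lambda>v. neighbours G v - S" and ?f = "cut_class G S"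
    define a where "a v = card (?N v) - (m - 1)" for v
    \<comment> \<open>Otherwise \<open>linked_deficient\<close> supplies sets \<open>R v\<close>,
      and \<open>not_arrows_of_deficient\<close> turns them into a colouring that avoids both
      graphs.\<close>
    have full: "(p + 1) * card T \<le> sum a T + 1" if "linked ?N T" "T \<subseteq> S" for T
    proof (rule ccontr)
      assume "\<not> ?thesis"
      then have "\<exists>T' \<subseteq> T. \<exists>R. (\<forall>v \<in> T'. R v \<subseteq> ?N v \<and> a v \<le> card (R v)) \<and>
        card (\<Union>v \<in> T'. R v) < p * card T'"
        using that(1) assms(6) finite_neighbours[OF G(1)]
        by (intro linked_deficient) (auto simp: a_def)
      then obtain T' R where T': "T' \<subseteq> T" "card (\<Union>v \<in> T'. R v) < p * card T'"
        and R: "\<And>v. v \<in> T' \<Longrightarrow> R v \<subseteq> ?N v" "\<And>v. v \<in> T' \<Longrightarrow> a v \<le> card (R v)"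
        by blast
      have "card (?N v) < m + card (R v)" if "v \<in> T'" for v
        using R(2)[OF that] assms(4) unfolding a_def by linarith
      then show False
        using not_arrows_of_deficient[OF G(1) assms(4,6) SV 1 small _ T'(2) R(1)] T'(1) that(2) arr
        by blast
    qed
    \<comment> \<open>For a single vertex \<open>full\<close> gives \<open>a v \<ge> p\<close>,
      which is positive, so the truncated subtraction in \<open>a\<close> has lost nothing.\<close>
    have "card (?N v) = a v + (m - 1)" if "v \<in> S" for v
      using full[OF linked.single[of _ v]] that assms(6) unfolding a_def by simp
    then have "(\<Sum>v \<in> S. card (?N v)) = sum a S + n * (m - 1)"
      using 1 by (simp add: sum.distrib)
    then have E: "sum a S + n * (m - 1) + card (?f ` S) \<le> card (edges G) + 1"
      using card_edges_ge_of_cut_classes[OF G SV] by simp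
    \<comment> \<open>Each cut class is the fibre of its own label, so sums over \<open>S\<close>
      can be regrouped by class.\<close>
    have fibre: "{x \<in> S. ?f x = T} = T" if T: "T \<in> ?f ` S" for T
    proof -
      obtain v where v: "v \<in> S" "T = ?f v" using T by blast
      have "x \<in> ?f v \<longleftrightarrow> ?f x = ?f v" if "x \<in> S" for x
      proof
        show "?f x = ?f v" if "x \<in> ?f v"
          using that cut_class_eq[of v x G S] unfolding cut_class_def by simp
        have "x \<in> ?f x" using \<open>x \<in> S\<close> unfolding cut_class_def by simp
        then show "x \<in> ?f v" if "?f x = ?f v" using that by simp
      qed
      moreover have "?f v \<subseteq> S" unfolding cut_class_def by blast
      ultimately show ?thesis using v(2) by blast
    qed
    have "(p + 1) * n = (\<Sum>v \<in> S. p + 1)" using 1 by simp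
    also have "\<dots> = (\<Sum>T \<in> ?f ` S. \<Sum>v | v \<in> S \<and> ?f v = T. p + 1)"
      by (rule sum.image_gen[OF finS])
    also have "\<dots> = (\<Sum>T \<in> ?f ` S. (p + 1) * card T)"
      using fibre by (intro sum.cong) (simp_all add: mult.commute)
    also have "\<dots> \<le> (\<Sum>T \<in> ?f ` S. sum a T + 1)"
      using full linked_cut_class[OF finS, of _ G]
      by (intro sum_mono) (auto simp: cut_class_def)
    also have "\<dots> = (\<Sum>T \<in> ?f ` S. \<Sum>v | v \<in> S \<and> ?f v = T. a v) + card (?f ` S)"
      unfolding sum.distrib using fibre by simp
    also have "\<dots> = sum a S + card (?f ` S)"
      using sum.image_gen[OF finS, of a ?f] by simp
    \<comment> \<open>The loss of one per component in \<open>full\<close> is made good by the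
      connecting edges counted in \<open>E\<close>, up to a final 1.\<close>
    finally have "(p + 1) * n + n * (m - 1) \<le> card (edges G) + 1" using E by linarith
    moreover have "(p + 1) * n + n * (m - 1) = n * (m + p)"
      using assms(4) by (cases m) (simp_all add: algebra_simps)
    ultimately show ?thesis by linarith
  qed
qed

section \<open>The upper bound\<close>

text \<open>
  The spine consists of the multiples of $d$.  The vertex $x > 0$ is joined to the largest
  multiple of $d$ below it, so $(i + 1) d$ is joined to $i d$.
\<close>

definition caterpillar :: "nat \<Rightarrow> nat \<Rightarrow> nat graph" where
  "caterpillar n d = \<lparr>verts = {..<n * d}, edges = (\<lambda>x. {(x - 1) div d * d, x}) ` {1..<n * d}\<rparr>"

text \<open>Each edge is thereby determined by its larger endpoint. This makes the edges two-element
  and distinct, and lets an induction follow them down to 0.\<close>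

lemma caterpillar_parent_less: "x \<ge> 1 \<Longrightarrow> (x - 1) div d * d < (x::nat)"
  by (metis One_nat_def Suc_le_lessD Suc_pred div_times_less_eq_dividend le_imp_less_Suc)

lemma simple_graph_caterpillar: "simple_graph (caterpillar n d)"
proof -
  have "{(x - 1) div d * d, x} \<subseteq> {..<n * d} \<and> card {(x - 1) div d * d, x} = 2"
    if "x \<in> {1..<n * d}" for x
  proof -
    have "(x - 1) div d * d < x" "x < n * d" using caterpillar_parent_less[of x d] that by auto
    moreover from this have "(x - 1) div d * d < n * d" by (rule less_trans)
    ultimately show ?thesis by simp
  qed
  then show ?thesis unfolding simple_graph_def caterpillar_def by auto
qed

lemma card_edges_caterpillar: "card (edges (caterpillar n d)) = n * d - 1"
proof -
  have "inj_on (\<lambda>x. {(x - 1) div d * d, x}) {1..<n * d}"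
  proof (rule inj_onI)
    fix x y assume "x \<in> {1..<n * d}" "y \<in> {1..<n * d}"
      "{(x - 1) div d * d, x} = {(y - 1) div d * d, y}"
    then show "x = y"
      using caterpillar_parent_less[of x d] caterpillar_parent_less[of y d] by (auto simp: doubleton_eq_iff)
  qed
  then show ?thesis unfolding caterpillar_def by (simp add: card_image)
qed

lemma connected_graph_caterpillar:
  assumes "n \<ge> 1" "d \<ge> 1"
  shows "connected_graph (caterpillar n d)"
proof -
  let ?r = "{(x, y). {x, y} \<in> edges (caterpillar n d)}"
  have root: "(0, x) \<in> ?r\<^sup>*" if "x < n * d" for x
    using that
  proof (induction x rule: less_induct)
    case (less x)
    show ?case
    proof (cases "x = 0")
      case False
      let ?y = "(x - 1) div d * d"
      have y: "?y < x" using caterpillar_parent_less[of x d] False by simp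
      have "(?y, x) \<in> ?r" using False less.prems unfolding caterpillar_def by auto
      then show ?thesis using less.IH[OF y] y less.prems by (meson less_trans rtrancl.rtrancl_into_rtrancl)
    qed simp
  qed
  have "sym (?r\<^sup>*)" by (intro sym_rtrancl symI) (simp add: insert_commute)
  then have "(x, y) \<in> ?r\<^sup>*" if "x < n * d" "y < n * d" for x y
    using root[OF that(1)] root[OF that(2)] by (meson rtrancl_trans symD)
  moreover have "verts (caterpillar n d) = {..<n * d}" unfolding caterpillar_def by simp
  moreover have "0 < n * d" using assms by simp
  then have "{..<n * d} \<noteq> {}" by blast
  ultimately show ?thesis unfolding connected_graph_def by simp
qed

text \<open>A spine vertex is joined to the other \<open>m + p - 1\<close> vertices of its block of
  length \<open>m + p\<close>. If fewer than \<open>m\<close> of these edges are blue, at least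
  \<open>p\<close> are red, and disjoint blocks give disjoint stars.\<close>

lemma arrows_caterpillar:
  assumes "p \<ge> 1" "m \<ge> 1"
  shows "arrows (caterpillar n (m + p)) (disjoint_copies n (star p)) (star m)"
proof -
  let ?d = "m + p"
  let ?G = "caterpillar n ?d"
  have "embeds (disjoint_copies n (star p)) (colour_class ?G c Red)"
    if no_blue: "\<not> embeds (star m) (colour_class ?G c Blue)" for c
  proof -
    \<comment> \<open>Edges between spine vertices are left out, which keeps the stars of different
      blocks disjoint.\<close>
    define red where "red i =
      {x \<in> {i * ?d<..<i * ?d + ?d}. {i * ?d, x} \<in> edges ?G \<and> c {i * ?d, x} = Red}" for i
    have "\<exists>h. inj_on h {1..p} \<and> h ` {1..p} \<subseteq> red i" if i: "i < n" for i
    proof -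
      let ?I = "{i * ?d<..<i * ?d + ?d}"
      let ?blue = "neighbours (colour_class ?G c Blue) (i * ?d)"
      have end_le: "i * ?d + ?d \<le> n * ?d"
        using mult_le_mono1[of "Suc i" n ?d] i by simp
      have "{i * ?d, x} \<in> edges ?G" if x: "x \<in> ?I" for x
      proof -
        have "(x - 1) div ?d = i" using x by (intro div_nat_eqI) (auto simp: mult.commute[of i])
        then show ?thesis using x end_le unfolding caterpillar_def by (auto intro!: image_eqI[of _ _ x])
      qed
      then have "?I \<subseteq> red i \<union> ?blue"
        unfolding red_def neighbours_def colour_class_def using colour.exhaust by auto
      moreover have finb: "finite ?blue"
        by (intro finite_neighbours simple_graph_colour_class simple_graph_caterpillar)
      ultimately have "card ?I \<le> card (red i \<union> ?blue)" by (intro card_mono) (auto simp: red_def)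
      also have "\<dots> \<le> card (red i) + card ?blue" by (rule card_Un_le)
      finally have "m + p - 1 \<le> card (red i) + card ?blue" by simp
      moreover have "i * ?d \<in> verts (colour_class ?G c Blue)"
        using i assms unfolding caterpillar_def colour_class_def by simp
      then have "card ?blue < m"
        using no_blue embeds_star_iff[OF simple_graph_colour_class[OF simple_graph_caterpillar]]
        by (meson not_le)
      ultimately have "p \<le> card (red i)" by linarith
      then obtain W where W: "W \<subseteq> red i" "card W = p" "finite W"
        using obtain_subset_with_card_n by blast
      obtain h where "bij_betw h {1..p} W"
        using finite_same_card_bij[OF _ W(3), of "{1..p}"] W(2) by auto
      then show ?thesis using W(1) unfolding bij_betw_def by auto
    qed
    then obtain h where h: "\<And>i. i < n \<Longrightarrow> inj_on (h i) {1..p} \<and> h i ` {1..p} \<subseteq> red i"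
      by metis
    define g where "g = (\<lambda>(i, j). if j = 0 then i * ?d else h i j)"
    have hI: "h i j \<in> {i * ?d<..<i * ?d + ?d} \<and> {i * ?d, h i j} \<in> edges ?G \<and>
        c {i * ?d, h i j} = Red" if "i < n" "j \<in> {1..p}" for i j
      using h[OF that(1)] that(2) unfolding red_def by blast
    have gI: "i * ?d \<le> g (i, j)" "g (i, j) < i * ?d + ?d" "g (i, j) = i * ?d \<longleftrightarrow> j = 0"
      if "i < n" "j \<le> p" for i j
      using hI[OF that(1), of j] that assms unfolding g_def by (cases "j = 0"; auto)+
    \<comment> \<open>Division by \<open>m + p\<close> recovers the index of the star, so only
      injectivity within one star remains.\<close>
    have gdiv: "g (i, j) div ?d = i" if "i < n" "j \<le> p" for i j
      using gI[OF that] by (intro div_nat_eqI) (auto simp: mult.commute)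
    have "inj_on g ({..<n} \<times> {0..p})"
    proof (rule inj_onI)
      fix x y assume xy: "x \<in> {..<n} \<times> {0..p}" "y \<in> {..<n} \<times> {0..p}" "g x = g y"
      obtain i j k l where ijkl: "x = (i, j)" "y = (k, l)" by (cases x, cases y)
      then have ij: "i \<in> {..<n}" "j \<in> {0..p}" "k \<in> {..<n}" "l \<in> {0..p}" "g (i, j) = g (k, l)"
        using xy by auto
      then have ik: "i = k" using gdiv[of i j] gdiv[of k l] by simp
      have "j = l"
      proof (cases "j = 0 \<or> l = 0")
        case True
        then show ?thesis using ij ik gI(3)[of i j] gI(3)[of i l] by auto
      next
        case False
        then show ?thesis
          using ij ik inj_onD[of "h i" "{1..p}" j l] h[of i] unfolding g_def by auto
      qed
      then show "x = y" using ijkl ik by simp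
    qed
    moreover have "g ` ({..<n} \<times> {0..p}) \<subseteq> {..<n * ?d}"
    proof (rule image_subsetI)
      fix x assume "x \<in> {..<n} \<times> {0..p}"
      then obtain i j where x: "x = (i, j)" and ij: "i < n" "j \<le> p" by auto
      then have "i * ?d + ?d \<le> n * ?d" using mult_le_mono1[of "Suc i" n ?d] by simp
      then have "g (i, j) < n * ?d" using gI(2)[OF ij] by (rule less_le_trans[rotated])
      then show "g x \<in> {..<n * ?d}" unfolding x lessThan_iff .
    qed
    moreover have "{g (i, 0), g (i, j)} \<in> edges (colour_class ?G c Red)"
      if "i < n" "j \<in> {1..p}" for i j
      using hI[OF that] that(2) unfolding g_def colour_class_def by simp
    ultimately show ?thesis
      unfolding embeds_disjoint_stars_iff
      by (intro exI[of _ g]) (simp add: colour_class_def caterpillar_def)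
  qed
  then show ?thesis
    unfolding arrows_iff_embeds[OF simple_graph_disjoint_copies[OF simple_graph_star] simple_graph_star]
    by blast
qed

theorem theorem1:
  fixes m n p :: nat
  assumes "m \<ge> 1" and "n \<ge> 1" and "p \<ge> 1"
    and "real m \<ge> ((real n)\<^sup>2 + 2 * real p * real n + real n - 3) / 2"
  shows "connected_size_ramsey (disjoint_copies n (star p)) (star m) = n * (m + p) - 1"
proof -
  have "real (n\<^sup>2 + 2 * p * n + n) \<le> real (2 * m + 3)"
    using assms(4) by simp
  then have "n\<^sup>2 + 2 * p * n + n \<le> 2 * m + 3" by (rule of_nat_le_iff[THEN iffD1])
  \<comment> \<open>Parity improves the bound by one, to the form in which the edge count for
    \<open>n + 1\<close> vertices of large degree uses it.\<close>
  moreover have "even (n\<^sup>2 + 2 * p * n + n)" "odd (2 * m + 3)" by auto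
  ultimately have large: "n\<^sup>2 + 2 * p * n + n \<le> 2 * m + 2"
    by presburger
  show ?thesis
    unfolding connected_size_ramsey_def
  proof (rule Least_equality)
    show "\<exists>G :: nat graph. simple_graph G \<and> connected_graph G \<and>
        arrows G (disjoint_copies n (star p)) (star m) \<and> card (edges G) = n * (m + p) - 1"
      using simple_graph_caterpillar connected_graph_caterpillar[of n "m + p"] arrows_caterpillar card_edges_caterpillar assms
      by (intro exI[of _ "caterpillar n (m + p)"]) simp
  qed (use card_edges_ge_of_arrows assms large in blast)
qed

end
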